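(* Let $X$ be any set and let $S$ be a system (set) of mutually disjoint subsets of $X$. Then there exists a total order on $X$ such that for all $A,B\in S$ with $A\neq B$, one has $A<B$ or $B<A$.
   Context: A total order (linear order) $\leq$ on $X$ is a reflexive, antisymmetric, transitive relation in which any two elements are comparable; $x<y$ means $x\leq y$ and $x\neq y$. For subsets $A,B$ of the totally ordered set $X$, $A<B$ means that $x<y$ for every $x\in A$ and every $y\in B$. "Mutually disjoint" means that any two distinct members of $S$ have empty intersection. *)

theory Defs
  imports Main "HOL-Library.Disjoint_Sets"
begin

definition set_less :: "'a rel \<Rightarrow> 'a set \<Rightarrow> 'a set \<Rightarrow> bool" where
  "set_less r A B \<longleftrightarrow> (\<forall>x\<in>A. \<forall>y\<in>B. (x, y) \<in> r \<and> x \<noteq> y)"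

end

theory Submission
  imports Defs
begin

text \<open>
  Order the points of \<^term>\<open>X\<close> lexicographically: first by the block of \<^term>\<open>S\<close> containing them
  (the empty set for points lying in no block), compared in a well-order of all subsets, then by
  a well-order of the points. Distinct blocks are then compared by their first components only.
\<close>

text \<open>Pulling \<open>q\<close> back along \<open>f\<close> gives only a total preorder, since
  \<open>f\<close> may identify points. Breaking these ties by \<open>w\<close> restores
  antisymmetry.\<close>

lemma linear_order_on_lexicographic:
  fixes f :: "'a \<Rightarrow> 'b" and q :: "'b rel" and w :: "'a rel"
  assumes q: "linear_order q" and w: "linear_order w"
  shows "linear_order_on X {(x, y) \<in> X \<times> X. (f x, f y) \<in> q \<and> (f x = f y \<longrightarrow> (x, y) \<in> w)}"
proof -
  have refl: "(u, u) \<in> q" "(x, x) \<in> w" for u x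
    using q w by (auto simp: order_on_defs refl_on_def)
  have trans: "trans q" "trans w" and antisym: "antisym q" "antisym w"
    using q w by (auto simp: order_on_defs)
  have total: "(u, v) \<in> q \<or> (v, u) \<in> q" "(x, y) \<in> w \<or> (y, x) \<in> w" for u v x y
    using q w refl unfolding order_on_defs total_on_def by (metis UNIV_I)+
  let ?r = "{(x, y) \<in> X \<times> X. (f x, f y) \<in> q \<and> (f x = f y \<longrightarrow> (x, y) \<in> w)}"
  have "refl_on X ?r"
    using refl by (auto simp: refl_on_def)
  moreover have "trans ?r"
  proof (rule transI)
    fix x y z
    assume xy: "(x, y) \<in> ?r" and yz: "(y, z) \<in> ?r"
    then have "(f x, f z) \<in> q"
      using transD[OF trans(1)] by blast
    moreover have "(x, z) \<in> w" if "f x = f z"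
    proof -
      \<comment> \<open>With \<open>f x = f z\<close>, the value \<open>f y\<close> lies both above
        and below \<open>f x\<close> in \<open>q\<close>, so antisymmetry makes all three equal and
        both comparisons pass to \<open>w\<close>.\<close>
      have "f x = f y"
        using xy yz that antisymD[OF antisym(1)] by auto
      then show ?thesis
        using xy yz that transD[OF trans(2)] by auto
    qed
    ultimately show "(x, z) \<in> ?r"
      using xy yz by auto
  qed
  moreover have "antisym ?r"
    using antisym by (auto intro!: antisymI dest: antisymD)
  moreover have "total_on X ?r"
    unfolding total_on_def
  proof (intro ballI impI)
    fix x y
    assume "x \<in> X" "y \<in> X"
    then show "(x, y) \<in> ?r \<or> (y, x) \<in> ?r"
      using total(1)[of "f x" "f y"] total(2)[of x y] refl(1)[of "f x"] by auto
  qed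
  ultimately show ?thesis
    by (auto simp: order_on_defs)
qed

theorem proposition7:
  fixes X :: "'a set" and S :: "'a set set"
  assumes "\<And>A. A \<in> S \<Longrightarrow> A \<subseteq> X" and "disjoint S"
  shows "\<exists>r. linear_order_on X r \<and>
    (\<forall>A\<in>S. \<forall>B\<in>S. A \<noteq> B \<longrightarrow> set_less r A B \<or> set_less r B A)"
proof -
  obtain q :: "'a set rel" where "well_order q"
    using well_order_on by blast
  then have q: "linear_order q"
    by (simp add: well_order_on_def)
  obtain w :: "'a rel" where "well_order w"
    using well_order_on by blast
  then have w: "linear_order w"
    by (simp add: well_order_on_def)
  \<comment> \<open>By disjointness at most one block contains \<open>x\<close>, so the union is
    that block, or \<open>{}\<close> if there is none.\<close>
  define f where "f x = \<Union>{A \<in> S. x \<in> A}" for x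
  have f: "f x = A" if "A \<in> S" "x \<in> A" for x A
  proof -
    have "{A \<in> S. x \<in> A} = {A}"
      using that \<open>disjoint S\<close> by (auto dest: disjointD)
    then show ?thesis
      by (simp add: f_def)
  qed
  let ?r = "{(x, y) \<in> X \<times> X. (f x, f y) \<in> q \<and> (f x = f y \<longrightarrow> (x, y) \<in> w)}"
  \<comment> \<open>On \<open>A\<close> and \<open>B\<close> the map \<open>f\<close> is constant
    with the distinct values \<open>A\<close> and \<open>B\<close>, so no tie occurs and
    \<open>q\<close> alone decides.\<close>
  have less: "set_less ?r A B" if "A \<in> S" "B \<in> S" "A \<noteq> B" "(A, B) \<in> q" for A B
    using that assms(1)[of A] assms(1)[of B] f[of A] f[of B] disjointD[OF assms(2), of A B]
    by (auto simp: set_less_def)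
  \<comment> \<open>Totality of \<open>q\<close> at the two blocks picks the direction.\<close>
  have "set_less ?r A B \<or> set_less ?r B A" if "A \<in> S" "B \<in> S" "A \<noteq> B" for A B
    using that q less[of A B] less[of B A] by (auto simp only: order_on_defs total_on_def)
  then show ?thesis
    using linear_order_on_lexicographic[OF q w, of X f] by blast
qed

end
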